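(* Fix $z_1\in\mathcal Z_1$ and $\xi\in\{1,\dots,\Xi\}$ (and a context $x$). For $y\in\mathcal Y$ let $S(z_1,y)=\{z_2\in\mathcal Z_2:\psi_\xi(z_1,z_2,y)\le0\}$. Suppose that for any $y_1,y_2\in\mathcal Y$ the sets $S(z_1,y_1)$ and $S(z_1,y_2)$ are convex and nested, i.e. $S(z_1,y_1)\subseteq S(z_1,y_2)$ or $S(z_1,y_2)\subseteq S(z_1,y_1)$. Then for any $0<\alpha_\xi<1$ the approximated feasible region generated by the $\xi$-th chance constraint, $$F_\xi(z_1)=\Big\{z_2\in\mathcal Z_2:\ \sum_{i=1}^N w_i(z_1,x)\,\mathbb I\{\psi_\xi(z_1,z_2,y_i)\le0\}\ge1-\alpha_\xi\Big\},$$ is convex.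
   Context: The decision is $z=(z_1,z_2)\in\mathcal Z_1\times\mathcal Z_2$ with $\mathcal Z_2$ a subset of a Euclidean space; $\psi_\xi$ are real-valued constraint functions of $(z_1,z_2,y)$, $y\in\mathcal Y$. $y_1,\dots,y_N\in\mathcal Y$ are the historical outcomes from data $\{(z_{1i},x_i,y_i)\}_{i=1}^N$. The weights are contextual cluster weights: $w_i(z_1,x)=\mathbb I\{(z_{1i},x_i)\in\mathcal C(z_1,x)\}/|\mathcal C(z_1,x)|$, where $\mathcal C(z_1,x)$ is a nonempty subset (cluster) of the historical data points attached to the query $(z_1,x)$; thus the points in the cluster have equal weight $1/|\mathcal C(z_1,x)|$ and the others have weight $0$. For fixed $z_1$ and $x$ the weights do not depend on $z_2$. *)

theory Defs
  imports "HOL-Analysis.Analysis"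
begin

(* The historical decisions z1d, contexts xd and outcomes yd are indexed by {1..N}.  C z1 x is the
   cluster of the query (z1, x), a set of historical points (z1d i, xd i);
   if a point occurs at several indices, each of these indices gets weight 1 / |C z1 x|. *)

definition cluster_weight ::
  "(nat \<Rightarrow> 'a) \<Rightarrow> (nat \<Rightarrow> 'c) \<Rightarrow> ('a \<Rightarrow> 'c \<Rightarrow> ('a \<times> 'c) set) \<Rightarrow> nat \<Rightarrow> 'a \<Rightarrow> 'c \<Rightarrow> real"
  where "cluster_weight z1d xd C i z1 x =
    of_bool ((z1d i, xd i) \<in> C z1 x) / real (card (C z1 x))"

definition satisfying_set ::
  "'b set \<Rightarrow> ('a \<Rightarrow> 'b \<Rightarrow> 'y \<Rightarrow> real) \<Rightarrow> 'a \<Rightarrow> 'y \<Rightarrow> 'b set"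
  where "satisfying_set Z2 g z1 y = {z2 \<in> Z2. g z1 z2 y \<le> 0}"

definition approx_feasible_region ::
  "'b set \<Rightarrow> ('a \<Rightarrow> 'b \<Rightarrow> 'y \<Rightarrow> real) \<Rightarrow> nat \<Rightarrow> (nat \<Rightarrow> 'y) \<Rightarrow> (nat \<Rightarrow> 'a \<Rightarrow> 'c \<Rightarrow> real) \<Rightarrow>
    real \<Rightarrow> 'a \<Rightarrow> 'c \<Rightarrow> 'b set"
  where "approx_feasible_region Z2 g N yd w \<alpha> z1 x =
    {z2 \<in> Z2. (\<Sum>i=1..N. w i z1 x * of_bool (g z1 z2 (yd i) \<le> 0)) \<ge> 1 - \<alpha>}"

end

theory Submission
  imports Defs
begin

text \<open>
  For two points \<open>u\<close> and \<open>v\<close> consider the indices of the convex sets that contain them. As the sets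
  form a chain, one of these two index sets lies in the other: if one set contained only \<open>u\<close> and
  another only \<open>v\<close>, neither would include the other. The sets of the smaller index set
  contain both points, hence by convexity the whole segment. So no point of the segment carries
  less weight than the lighter of the two endpoints, and the superlevel sets of
  the total weight are convex (\<open>convex_weighted_cover_superlevel\<close>). The approximated feasible region
  is such a superlevel set: as the level \<open>1 - \<alpha>\<close> is positive, a point that reaches it
  satisfies the constraint for some outcome, which places it in \<open>Z2\<close> although \<open>Z2\<close> itself may
  fail to be convex.
\<close>

lemma convex_weighted_cover_superlevel:
  fixes S :: "'i \<Rightarrow> 'b::real_vector set" and w :: "'i \<Rightarrow> real"
  assumes nonneg: "\<And>i. i \<in> I \<Longrightarrow> 0 \<le> w i"
    and conv: "\<And>i. i \<in> I \<Longrightarrow> convex (S i)"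
    and nested: "\<And>i j. i \<in> I \<Longrightarrow> j \<in> I \<Longrightarrow> S i \<subseteq> S j \<or> S j \<subseteq> S i"
  shows "convex {p. t \<le> (\<Sum>i\<in>I. w i * of_bool (p \<in> S i))}"
proof (rule convexI)
  fix u v :: 'b and a b :: real
  assume u: "u \<in> {p. t \<le> (\<Sum>i\<in>I. w i * of_bool (p \<in> S i))}"
    and v: "v \<in> {p. t \<le> (\<Sum>i\<in>I. w i * of_bool (p \<in> S i))}"
    and ab: "0 \<le> a" "0 \<le> b" "a + b = 1"
  define p where "p = a *\<^sub>R u + b *\<^sub>R v"
  have segment: "p \<in> S i" if "i \<in> I" "u \<in> S i" "v \<in> S i" for i
    unfolding p_def using conv[OF that(1)] that(2,3) ab by (rule convexD)
  have mono: "(\<Sum>i\<in>I. w i * of_bool (q \<in> S i)) \<le> (\<Sum>i\<in>I. w i * of_bool (p \<in> S i))"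
    if "\<And>i. i \<in> I \<Longrightarrow> q \<in> S i \<Longrightarrow> p \<in> S i" for q
    by (intro sum_mono mult_left_mono) (use that nonneg in auto)
  have "(\<forall>i\<in>I. u \<in> S i \<longrightarrow> v \<in> S i) \<or> (\<forall>i\<in>I. v \<in> S i \<longrightarrow> u \<in> S i)"
    using nested by blast
  then have "t \<le> (\<Sum>i\<in>I. w i * of_bool (p \<in> S i))"
  proof
    assume "\<forall>i\<in>I. u \<in> S i \<longrightarrow> v \<in> S i"
    then show ?thesis using mono[of u] segment u by force
  next
    assume "\<forall>i\<in>I. v \<in> S i \<longrightarrow> u \<in> S i"
    then show ?thesis using mono[of v] segment v by force
  qed
  then show "a *\<^sub>R u + b *\<^sub>R v \<in> {p. t \<le> (\<Sum>i\<in>I. w i * of_bool (p \<in> S i))}"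
    by (simp add: p_def)
qed

lemma cluster_weight_nonneg: "0 \<le> cluster_weight z1d xd C i z1 x"
  by (simp add: cluster_weight_def)

text \<open>
  A positive level removes the side condition \<open>z2 \<in> Z2\<close>: outside \<open>Z2\<close> no satisfying set contributes,
  so the sum is \<open>0\<close>.
\<close>

lemma approx_feasible_region_eq_superlevel:
  assumes "\<alpha> < 1"
  shows "approx_feasible_region Z2 g N yd w \<alpha> z1 x =
    {z2. 1 - \<alpha> \<le> (\<Sum>i=1..N. w i z1 x * of_bool (z2 \<in> satisfying_set Z2 g z1 (yd i)))}"
proof (rule set_eqI)
  fix z2
  show "z2 \<in> approx_feasible_region Z2 g N yd w \<alpha> z1 x \<longleftrightarrow>
    z2 \<in> {z2. 1 - \<alpha> \<le> (\<Sum>i=1..N. w i z1 x * of_bool (z2 \<in> satisfying_set Z2 g z1 (yd i)))}"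
    using assms by (cases "z2 \<in> Z2") (simp_all add: approx_feasible_region_def satisfying_set_def)
qed

theorem lemma4:
  fixes Z1 :: "'a set" and Z2 :: "'b::euclidean_space set" and Y :: "'y set"
    and \<psi> :: "nat \<Rightarrow> 'a \<Rightarrow> 'b \<Rightarrow> 'y \<Rightarrow> real" and \<Xi> :: nat and \<xi> :: nat
    and N :: nat and z1d :: "nat \<Rightarrow> 'a" and xd :: "nat \<Rightarrow> 'c" and yd :: "nat \<Rightarrow> 'y"
    and C :: "'a \<Rightarrow> 'c \<Rightarrow> ('a \<times> 'c) set"
    and \<alpha> :: "nat \<Rightarrow> real" and z1 :: 'a and x :: 'c
  assumes "z1 \<in> Z1"
    and "\<xi> \<in> {1..\<Xi>}"
    and "\<And>i. i \<in> {1..N} \<Longrightarrow> yd i \<in> Y"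
    and "C z1 x \<noteq> {}"
    and "C z1 x \<subseteq> (\<lambda>i. (z1d i, xd i)) ` {1..N}"
    and "\<And>y. y \<in> Y \<Longrightarrow> convex (satisfying_set Z2 (\<psi> \<xi>) z1 y)"
    and "\<And>y y'. y \<in> Y \<Longrightarrow> y' \<in> Y \<Longrightarrow>
      satisfying_set Z2 (\<psi> \<xi>) z1 y \<subseteq> satisfying_set Z2 (\<psi> \<xi>) z1 y' \<or>
      satisfying_set Z2 (\<psi> \<xi>) z1 y' \<subseteq> satisfying_set Z2 (\<psi> \<xi>) z1 y"
    and "0 < \<alpha> \<xi>" and "\<alpha> \<xi> < 1"
  shows "convex (approx_feasible_region Z2 (\<psi> \<xi>) N yd (cluster_weight z1d xd C) (\<alpha> \<xi>) z1 x)"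
proof -
  have "convex {z2. 1 - \<alpha> \<xi> \<le> (\<Sum>i=1..N. cluster_weight z1d xd C i z1 x *
      of_bool (z2 \<in> satisfying_set Z2 (\<psi> \<xi>) z1 (yd i)))}"
  proof (rule convex_weighted_cover_superlevel)
    fix i j assume "i \<in> {1..N}" and "j \<in> {1..N}"
    then show "satisfying_set Z2 (\<psi> \<xi>) z1 (yd i) \<subseteq> satisfying_set Z2 (\<psi> \<xi>) z1 (yd j) \<or>
      satisfying_set Z2 (\<psi> \<xi>) z1 (yd j) \<subseteq> satisfying_set Z2 (\<psi> \<xi>) z1 (yd i)"
      by (intro assms(3) assms(7))
  qed (simp_all only: cluster_weight_nonneg assms(3,6))
  then show ?thesis
    by (simp only: approx_feasible_region_eq_superlevel[OF \<open>\<alpha> \<xi> < 1\<close>])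
qed

end
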